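(* Let $B\subset S$ be any set of patterns with $1\notin B$ whose corresponding directed graph $D[B]$ has $\alpha$-growing paths with $V^{(1)},\ldots,V^{(\alpha)},W$, where $V^{(i)}=\{v^{(i)}_j : j\ge 0\}$. If the generating function $\sum_{j\geq0}M[B](v_j^{(i)},w)x^j$ is rational for each $i\in\{1,\dots,\alpha\}$ and each $w\in W$, then $G_B(x)$ is rational (i.e. it is the power series expansion at $0$ of a rational function of $x$).
   Context: Permutations and patterns. $S_n$ is the set of permutations of $[n]=\{1,\dots,n\}$ written as words, $S=\bigcup_{n\ge1}S_n$, and $|\pi|=n$ for $\pi\in S_n$. The permutation of length one is denoted $1$. A permutation $\sigma\in S_n$ contains $\tau\in S_k$ if there are indices $i_1<\dots<i_k$ such that $\sigma(i_a)<\sigma(i_b)$ iff $\tau(a)<\tau(b)$ for all $a,b$; otherwise it avoids $\tau$. $S_n(B)$ is the set of permutations in $S_n$ avoiding every $\tau\in B$, $S(B)=\bigcup_{n\ge 1}S_n(B)$, and $G_B(x)=\sum_{n\ge1}|S_n(B)|x^n$. Pattern-avoidance tree. $T(B)$ is the rooted tree with root $1$ whose $n$-th level is $S_n(B)$ (the root is level $1$); the parent of $\pi\in S_n(B)$, $n\ge2$, is the permutation in $S_{n-1}(B)$ obtained by deleting the letter $n$ from $\pi$. For $\pi\in S(B)$, $T(B;\pi)$ is the subtree of $T(B)$ consisting of $\pi$ and all its descendants, with root $\pi$. Call $\pi,\pi'\in S(B)$ equivalent if $T(B;\pi)\cong T(B;\pi')$ as rooted trees. Each equivalence class is labeled by one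 fixed representative of minimal length in the class. The directed graph $D[B]$ and matrix $M[B]$. The nodes of $D[B]$ are these representatives (one per equivalence class). For nodes $v,w$, the number of edges from $v$ to $w$ is the number of children of $v$ in $T(B)$ that are equivalent to $w$ (so loops and multiple edges are allowed); this number is denoted $M[B](v,w)$. The length $|v|$ of a node $v$ is its length as a permutation. A succession rule $v\rightsquigarrow u_1,u_2,\dots$ lists the representatives of the classes of all children of $v$, with multiplicity; $(u)^r$ means that $u$ is listed $r$ times ($r=0$ meaning not at all). $\alpha$-growing paths. Let $\alpha\ge1$. Suppose the node set $V$ of $D[B]$ is partitioned into sets $V^{(1)},\dots,V^{(\alpha)}$ and $W$, where $V^{(j)}=\{v_i^{(j)} : i\ge0\}$ and $W=\{w_1,\dots,w_\ell\}$ is finite with $\ell\ge1$. Then $D[B]$ (or $V$) has $\alpha$-growing paths if: (i) $|v_i^{(1)}|=\cdots=|v_i^{(\alpha)}|=i+m$ for all $i\ge0$, where $m\ge1$ is fixed. (ii) Every node in $W$ has length at most $m$. (iii) The edges starting at members of $\bigcup_{j=1}^{\alpha}V^{(j)}$ are given by the following succession rules, for all $k\ge0$. For $V^{(1)}$: $$v_k^{(1)}\rightsquigarrow v_0^{(1)},\ldots,v_{k-1}^{(1)},(v_k^{(1)})^{r_1},(w_1)^{p_{1,1}^{(k)}},\ldots,(w_\ell)^{p_{1,\ell}^{(k)}}.$$ For each $s$ with $2\le s\le\alpha-1$, with some fixed $s'$ depending on $s$, $1\le s'<s$: $$v_k^{(s)}\rightsquigarrow v_0^{(s')},\ldots,v_{k-1}^{(s')},(v_k^{(s')})^{r_s},(v_{k+1}^{(s')})^{r_{s,1}},(v_k^{(s)})^{r_{s,2}},(w_1)^{p_{s,1}^{(k)}},\ldots,(w_\ell)^{p_{s,\ell}^{(k)}}.$$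 For $V^{(\alpha)}$ (when $\alpha\ge2$), with some fixed $\alpha'$, $1\le\alpha'<\alpha$: $$v_k^{(\alpha)}\rightsquigarrow v_0^{(\alpha')},\ldots,v_{k-1}^{(\alpha')},(v_k^{(\alpha')})^{r_\alpha},(v_k^{(\alpha)})^{r'_\alpha},(v_{k+1}^{(1)})^{r_{\alpha,1}},\ldots,(v_{k+1}^{(\alpha)})^{r_{\alpha,\alpha}},(w_1)^{p_{\alpha,1}^{(k)}},\ldots,(w_\ell)^{p_{\alpha,\ell}^{(k)}}.$$ Here the exponents $r'_\alpha$, $r_i$ and $r_{\alpha,i}$ ($1\le i\le\alpha$), $r_{i,1},r_{i,2}$ ($2\le i\le\alpha-1$) and $p^{(k)}_{i,j}$ ($k\ge0$, $1\le i\le\alpha$, $1\le j\le\ell$) are fixed non-negative integers; only the $p^{(k)}_{i,j}$ may depend on $k$. (iv) All other edges start at a node in $W$. *)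

theory Defs
  imports
    "HOL-Combinatorics.Multiset_Permutations"
    "HOL-Computational_Algebra.Polynomial_FPS"
begin

section \<open>Permutations and patterns\<close>

text \<open>
  A permutation of \<open>{1..n}\<close> is its word: the list \<open>[\<pi>(1), \<dots>, \<pi>(n)]\<close>. The library set
  \<open>permutations_of_set A\<close> consists of the lists enumerating \<open>A\<close> without repetition.
  The empty permutation is excluded from \<open>perms\<close> and \<open>avoiders\<close>.
\<close>

type_synonym perm = "nat list"

definition perms_of_length :: "nat \<Rightarrow> perm set" where
  "perms_of_length n = permutations_of_set {1..n}"

definition perms :: "perm set" where
  "perms = (\<Union>n\<in>{1..}. perms_of_length n)"

definition contains :: "perm \<Rightarrow> perm \<Rightarrow> bool" where
  "contains \<sigma> \<tau> \<longleftrightarrow>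
     (\<exists>f :: nat \<Rightarrow> nat. strict_mono_on {..<length \<tau>} f \<and> f ` {..<length \<tau>} \<subseteq> {..<length \<sigma>} \<and>
        (\<forall>a<length \<tau>. \<forall>b<length \<tau>. \<sigma> ! f a < \<sigma> ! f b \<longleftrightarrow> \<tau> ! a < \<tau> ! b))"

definition avoiders_of_length :: "nat \<Rightarrow> perm set \<Rightarrow> perm set" where
  "avoiders_of_length n B = {\<sigma> \<in> perms_of_length n. \<forall>\<tau>\<in>B. \<not> contains \<sigma> \<tau>}"

definition avoiders :: "perm set \<Rightarrow> perm set" where
  "avoiders B = (\<Union>n\<in>{1..}. avoiders_of_length n B)"

section \<open>The pattern-avoidance tree\<close>

text \<open>Deleting the largest letter \<open>n\<close> from a permutation of \<open>{1..n}\<close>.\<close>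

definition parent :: "perm \<Rightarrow> perm" where
  "parent \<pi> = removeAll (length \<pi>) \<pi>"

text \<open>The edges of \<open>T(B)\<close>, directed away from the root.\<close>

definition tree_edges :: "perm set \<Rightarrow> (perm \<times> perm) set" where
  "tree_edges B = {(parent \<pi>, \<pi>) | \<pi>. \<pi> \<in> avoiders B \<and> length \<pi> \<ge> 2}"

definition children :: "perm set \<Rightarrow> perm \<Rightarrow> perm set" where
  "children B \<pi> = tree_edges B `` {\<pi>}"

text \<open>The vertex set of \<open>T(B;\<pi>)\<close>; its edges are those of \<open>T(B)\<close> between these vertices.\<close>

definition subtree :: "perm set \<Rightarrow> perm \<Rightarrow> perm set" where
  "subtree B \<pi> = (tree_edges B)\<^sup>* `` {\<pi>}"

text \<open>Isomorphism of \<open>T(B;\<pi>)\<close> and \<open>T(B;\<pi>')\<close> as rooted trees.\<close>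

definition tree_equiv :: "perm set \<Rightarrow> perm \<Rightarrow> perm \<Rightarrow> bool" where
  "tree_equiv B \<pi> \<pi>' \<longleftrightarrow>
     (\<exists>f. bij_betw f (subtree B \<pi>) (subtree B \<pi>') \<and> f \<pi> = \<pi>' \<and>
        (\<forall>x\<in>subtree B \<pi>. \<forall>y\<in>subtree B \<pi>.
           (x, y) \<in> tree_edges B \<longleftrightarrow> (f x, f y) \<in> tree_edges B))"

section \<open>The directed graph \<open>D[B]\<close> and the matrix \<open>M[B]\<close>\<close>

text \<open>
  A labelling \<open>rep\<close> sends every \<open>\<pi> \<in> avoiders B\<close> to the fixed representative of its class. The
  choice of representatives is not canonical, so \<open>D[B]\<close> is taken relative to such a labelling.
\<close>

definition labelling :: "perm set \<Rightarrow> (perm \<Rightarrow> perm) \<Rightarrow> bool" where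
  "labelling B rep \<longleftrightarrow>
     (\<forall>\<pi>\<in>avoiders B. rep \<pi> \<in> avoiders B \<and> tree_equiv B \<pi> (rep \<pi>) \<and>
        (\<forall>\<pi>'\<in>avoiders B. tree_equiv B \<pi> \<pi>' \<longrightarrow> rep \<pi>' = rep \<pi> \<and> length (rep \<pi>) \<le> length \<pi>'))"

definition nodes :: "perm set \<Rightarrow> (perm \<Rightarrow> perm) \<Rightarrow> perm set" where
  "nodes B rep = rep ` avoiders B"

definition edge_count :: "perm set \<Rightarrow> perm \<Rightarrow> perm \<Rightarrow> nat" where
  "edge_count B v w = card {c \<in> children B v. tree_equiv B c w}"

text \<open>
  \<open>succession B rep v U\<close> is the succession rule for \<open>v\<close>: the multiset of the representatives of
  its children is \<open>U\<close>. (A permutation has only finitely many children, so \<open>mset_set\<close> applies.)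
\<close>

definition succession :: "perm set \<Rightarrow> (perm \<Rightarrow> perm) \<Rightarrow> perm \<Rightarrow> perm multiset \<Rightarrow> bool" where
  "succession B rep v U \<longleftrightarrow> image_mset rep (mset_set (children B v)) = U"

section \<open>Growing paths\<close>

text \<open>
  Here \<open>v j i\<close> is $v_i^{(j)}$, so that $V^{(j)}$ is \<open>range (v j)\<close> for \<open>1 \<le> j \<le> \<alpha>\<close>; the other
  values of \<open>j\<close> are irrelevant. As \<open>W\<close> is a set, the exponents $p_{i,j}^{(k)}$ are indexed by the
  element of \<open>W\<close> instead of its number: \<open>p i k w\<close>. The exponents $r_i$, $r_{i,j}$ and $r'_\alpha$
  are \<open>r i\<close>, \<open>rr i j\<close> and \<open>r'\<close>, and \<open>q s\<close> is $s'$, with \<open>q \<alpha>\<close> being $\alpha'$.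
\<close>

definition growing_paths ::
    "perm set \<Rightarrow> (perm \<Rightarrow> perm) \<Rightarrow> nat \<Rightarrow> (nat \<Rightarrow> nat \<Rightarrow> perm) \<Rightarrow> perm set \<Rightarrow> bool" where
  "growing_paths B rep \<alpha> v W \<longleftrightarrow>
     \<alpha> \<ge> 1 \<and> finite W \<and> W \<noteq> {} \<and>
     nodes B rep = (\<Union>j\<in>{1..\<alpha>}. range (v j)) \<union> W \<and>
     disjoint_family_on (\<lambda>j. range (v j)) {1..\<alpha>} \<and>
     (\<forall>j\<in>{1..\<alpha>}. range (v j) \<inter> W = {}) \<and>
     (\<exists>m\<ge>1. (\<forall>j\<in>{1..\<alpha>}. \<forall>i. length (v j i) = i + m) \<and> (\<forall>w\<in>W. length w \<le> m)) \<and>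
     (\<exists>(q :: nat \<Rightarrow> nat) (r :: nat \<Rightarrow> nat) (rr :: nat \<Rightarrow> nat \<Rightarrow> nat) (r' :: nat)
        (p :: nat \<Rightarrow> nat \<Rightarrow> perm \<Rightarrow> nat).
        (\<forall>k. succession B rep (v 1 k)
           (image_mset (v 1) (mset_set {..<k}) + replicate_mset (r 1) (v 1 k)
            + (\<Sum>w\<in>W. replicate_mset (p 1 k w) w))) \<and>
        (\<forall>s. 2 \<le> s \<and> s < \<alpha> \<longrightarrow> 1 \<le> q s \<and> q s < s \<and>
           (\<forall>k. succession B rep (v s k)
              (image_mset (v (q s)) (mset_set {..<k}) + replicate_mset (r s) (v (q s) k)
               + replicate_mset (rr s 1) (v (q s) (k + 1)) + replicate_mset (rr s 2) (v s k)
               + (\<Sum>w\<in>W. replicate_mset (p s k w) w)))) \<and>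
        (\<alpha> \<ge> 2 \<longrightarrow> 1 \<le> q \<alpha> \<and> q \<alpha> < \<alpha> \<and>
           (\<forall>k. succession B rep (v \<alpha> k)
              (image_mset (v (q \<alpha>)) (mset_set {..<k}) + replicate_mset (r \<alpha>) (v (q \<alpha>) k)
               + replicate_mset r' (v \<alpha> k)
               + (\<Sum>i\<in>{1..\<alpha>}. replicate_mset (rr \<alpha> i) (v i (k + 1)))
               + (\<Sum>w\<in>W. replicate_mset (p \<alpha> k w) w))))) \<and>
     (\<forall>x\<in>nodes B rep. \<forall>y\<in>nodes B rep.
        edge_count B x y > 0 \<and> x \<notin> (\<Union>j\<in>{1..\<alpha>}. range (v j)) \<longrightarrow> x \<in> W)"

section \<open>Generating functions\<close>

text \<open>
  A power series is rational if it is the expansion at \<open>0\<close> of a quotient \<open>a / b\<close> of polynomials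
  with \<open>b(0) \<noteq> 0\<close> (the division is that of power series).
\<close>

definition rational_fps :: "'a::field fps \<Rightarrow> bool" where
  "rational_fps F \<longleftrightarrow> (\<exists>a b. poly b 0 \<noteq> 0 \<and> F = fps_of_poly a / fps_of_poly b)"

definition avoiders_gf :: "perm set \<Rightarrow> 'a::field_char_0 fps" where
  "avoiders_gf B =
     Abs_fps (\<lambda>n. if n = 0 then 0 else of_nat (card (avoiders_of_length n B)))"

end

theory Submission
  imports Defs
begin

text \<open>
  Let \<open>F\<^sub>\<pi>(x)\<close> count the descendants of \<open>\<pi>\<close> by depth, so that \<open>F\<^sub>\<pi> = 1 + x \<Sum> F\<^sub>c\<close> over the
  children \<open>c\<close> of \<open>\<pi>\<close>, and let \<open>K\<close> be the local ring of rational power series in \<open>x\<close>. The key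
  claim is that every \<open>F\<^sub>\<pi>\<close> lies in the \<open>K\<close>-module \<open>M\<close> spanned by 1 and the \<open>F\<^sub>w\<close> with \<open>w \<in> W\<close>.
  Granting it, \<open>F\<^sub>w \<in> 1 + x M\<close>, and this finite linear system over \<open>K\<close> is invertible because it
  is the identity modulo \<open>x\<close>; so \<open>M = K\<close>.

  For the claim, mark the index \<open>k\<close> of the nodes \<open>v\<^sub>k\<close> of one growing path by a second variable
  \<open>y\<close>. For all paths but the last one (and for it too if \<open>\<alpha> = 1\<close>) the succession rules show
  inductively that the series in \<open>y\<close> is \<open>N(y) / D(y)\<close> with \<open>D \<in> K[y]\<close>, \<open>D(0)\<close> a unit, and
  \<open>N \<in> M[y]\<close>. On the last path the rule has the form \<open>f\<^sub>k = u\<^sub>k + Y f\<^sub>k\<^sub>+\<^sub>1\<close> with \<open>u\<close> of this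
  kind and \<open>Y \<in> x K\<close>, and the kernel method gives \<open>f\<^sub>k \<in> M\<close>.
\<close>

section \<open>Rational power series\<close>

text \<open>A polynomial with \<open>b(0) \<noteq> 0\<close> is a unit as a power series, so the
  denominator can be cleared; the closure properties below then reduce to ring identities.\<close>

lemma rational_fps_iff:
  "rational_fps F \<longleftrightarrow> (\<exists>a b. poly b 0 \<noteq> 0 \<and> F * fps_of_poly b = fps_of_poly a)"
proof -
  have "F = fps_of_poly a / fps_of_poly b \<longleftrightarrow> F * fps_of_poly b = fps_of_poly a"
    if "poly b 0 \<noteq> 0" for a b :: "'a poly"
  proof -
    have nz: "fps_nth (fps_of_poly b) 0 \<noteq> 0"
      using that by (simp add: poly_0_coeff_0)
    have inv: "inverse (fps_of_poly b) * fps_of_poly b = 1"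
      using nz by (rule inverse_mult_eq_1)
    show ?thesis
    proof
      assume "F = fps_of_poly a / fps_of_poly b"
      then have "F = fps_of_poly a * inverse (fps_of_poly b)"
        using nz by (simp add: fps_divide_unit)
      then show "F * fps_of_poly b = fps_of_poly a"
        using inv by (simp add: mult.assoc)
    next
      assume "F * fps_of_poly b = fps_of_poly a"
      then have "fps_of_poly a * inverse (fps_of_poly b)
          = F * (inverse (fps_of_poly b) * fps_of_poly b)"
        by (metis mult.assoc mult.commute)
      then show "F = fps_of_poly a / fps_of_poly b"
        using nz inv by (simp add: fps_divide_unit)
    qed
  qed
  then show ?thesis
    unfolding rational_fps_def by blast
qed

lemma rational_fps_of_poly: "rational_fps (fps_of_poly a)"
  unfolding rational_fps_iff by (intro exI[of _ a] exI[of _ 1]) simp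

lemma rational_fps_const: "rational_fps (fps_const c)"
  using rational_fps_of_poly[of "[:c:]"] by (simp add: fps_of_poly_const)

lemma rational_fps_0: "rational_fps 0"
  using rational_fps_const[of 0] by simp

lemma rational_fps_1: "rational_fps 1"
  using rational_fps_const[of 1] by simp

lemma rational_fps_of_nat: "rational_fps (of_nat n)"
  using rational_fps_const[of "of_nat n"] by (simp add: fps_of_nat)

lemma rational_fps_X: "rational_fps fps_X"
  using rational_fps_of_poly[of "monom 1 1"] by (simp add: fps_of_poly_monom)

lemma rational_fps_add:
  assumes "rational_fps F" "rational_fps G"
  shows "rational_fps (F + G)"
proof -
  obtain a b c d where ab: "poly b 0 \<noteq> 0" "F * fps_of_poly b = fps_of_poly a"
    and cd: "poly d 0 \<noteq> 0" "G * fps_of_poly d = fps_of_poly c"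
    using assms unfolding rational_fps_iff by blast
  have "(F + G) * fps_of_poly (b * d)
      = (F * fps_of_poly b) * fps_of_poly d + (G * fps_of_poly d) * fps_of_poly b"
    by (simp add: fps_of_poly_mult algebra_simps)
  also have "\<dots> = fps_of_poly (a * d + c * b)"
    by (simp add: ab cd fps_of_poly_mult fps_of_poly_add)
  finally show ?thesis
    unfolding rational_fps_iff using ab(1) cd(1)
    by (intro exI[of _ "a * d + c * b"] exI[of _ "b * d"]) simp
qed

lemma rational_fps_mult:
  assumes "rational_fps F" "rational_fps G"
  shows "rational_fps (F * G)"
proof -
  obtain a b c d where ab: "poly b 0 \<noteq> 0" "F * fps_of_poly b = fps_of_poly a"
    and cd: "poly d 0 \<noteq> 0" "G * fps_of_poly d = fps_of_poly c"
    using assms unfolding rational_fps_iff by blast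
  have "(F * G) * fps_of_poly (b * d) = (F * fps_of_poly b) * (G * fps_of_poly d)"
    by (simp add: fps_of_poly_mult algebra_simps)
  also have "\<dots> = fps_of_poly (a * c)"
    by (simp add: ab cd fps_of_poly_mult)
  finally show ?thesis
    unfolding rational_fps_iff using ab(1) cd(1)
    by (intro exI[of _ "a * c"] exI[of _ "b * d"]) simp
qed

lemma rational_fps_uminus: "rational_fps F \<Longrightarrow> rational_fps (- F)"
  using rational_fps_mult[OF rational_fps_const[of "-1"], of F] by (simp flip: fps_const_neg)

lemma rational_fps_diff: "rational_fps F \<Longrightarrow> rational_fps G \<Longrightarrow> rational_fps (F - G)"
  using rational_fps_add[OF _ rational_fps_uminus, of F G] by simp

text \<open>In \<open>F b = a\<close> the constant term of \<open>a\<close> is nonzero because those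
  of \<open>F\<close> and \<open>b\<close> are, so \<open>a\<close> can serve as a
  denominator.\<close>

lemma rational_fps_inverse:
  assumes "rational_fps F" "fps_nth F 0 \<noteq> 0"
  shows "rational_fps (inverse F)"
proof -
  obtain a b where ab: "poly b 0 \<noteq> 0" "F * fps_of_poly b = fps_of_poly a"
    using assms unfolding rational_fps_iff by blast
  have "fps_nth (F * fps_of_poly b) 0 \<noteq> 0"
    using assms(2) ab(1) by (simp add: poly_0_coeff_0)
  then have "poly a 0 \<noteq> 0"
    unfolding ab(2) by (simp add: poly_0_coeff_0)
  moreover have "inverse F * fps_of_poly a = (inverse F * F) * fps_of_poly b"
    unfolding ab(2)[symmetric] by (simp add: mult.assoc)
  ultimately show ?thesis
    unfolding rational_fps_iff using assms(2) by (auto simp: inverse_mult_eq_1)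
qed

lemma rational_fps_power: "rational_fps F \<Longrightarrow> rational_fps (F ^ n)"
  by (induction n) (auto intro: rational_fps_1 rational_fps_mult)

lemmas rational_fps_intros =
  rational_fps_const rational_fps_0 rational_fps_1 rational_fps_of_nat rational_fps_X
  rational_fps_add rational_fps_mult rational_fps_uminus rational_fps_diff rational_fps_power

lemma rational_fps_sum: "(\<And>i. i \<in> I \<Longrightarrow> rational_fps (f i)) \<Longrightarrow> rational_fps (sum f I)"
  by (induction I rule: infinite_finite_induct) (auto intro: rational_fps_intros)

text \<open>Gaussian elimination by induction on \<open>W\<close>. The pivot
  \<open>1 - x A z\<close> has constant term 1 and is therefore a unit, and eliminating
  \<open>z\<close> leaves a system of the same shape.\<close>

lemma rational_fps_linear_system:
  fixes g :: "'b \<Rightarrow> 'a::field fps"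
  assumes "finite W"
    and "\<And>w. w \<in> W \<Longrightarrow> \<exists>c A. rational_fps c \<and> (\<forall>u. rational_fps (A u)) \<and>
           g w = c + fps_X * (\<Sum>u\<in>W. A u * g u)"
    and "w \<in> W"
  shows "rational_fps (g w)"
  using assms
proof (induction W arbitrary: w rule: finite_induct)
  case (insert z W)
  obtain c A where c: "rational_fps c" and A: "\<And>u. rational_fps (A u)"
    and gz: "g z = c + fps_X * (\<Sum>u\<in>insert z W. A u * g u)"
    using insert.prems(1)[of z] by blast
  define e where "e = inverse (1 - fps_X * A z)"
  have e: "rational_fps e"
    unfolding e_def using A by (auto intro!: rational_fps_inverse rational_fps_intros)
  have "e * (1 - fps_X * A z) = 1"
    unfolding e_def by (rule inverse_mult_eq_1) simp
  moreover have "(1 - fps_X * A z) * g z = c + fps_X * (\<Sum>u\<in>W. A u * g u)"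
    using gz insert.hyps by (simp add: algebra_simps)
  ultimately have gz': "g z = e * (c + fps_X * (\<Sum>u\<in>W. A u * g u))"
    using mult.assoc[of e "1 - fps_X * A z" "g z"] by simp
  have ih: "rational_fps (g u)" if "u \<in> W" for u
    using that
  proof (rule insert.IH[rotated])
    fix y assume "y \<in> W"
    then obtain d D where d: "rational_fps d" and D: "\<And>u. rational_fps (D u)"
      and gy: "g y = d + fps_X * (\<Sum>u\<in>insert z W. D u * g u)"
      using insert.prems(1)[of y] by blast
    \<comment> \<open>Separating the \<open>z\<close> term allows the solved equation
      \<open>gz'\<close> to be substituted; the new coefficients remain rational.\<close>
    have "g y = d + fps_X * (D z * g z) + fps_X * (\<Sum>u\<in>W. D u * g u)"
      using gy insert.hyps by (simp add: algebra_simps)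
    also have "\<dots> = (d + fps_X * D z * e * c)
        + fps_X * (\<Sum>u\<in>W. (fps_X * D z * e * A u + D u) * g u)"
      unfolding gz'
      by (simp add: algebra_simps sum.distrib sum_distrib_left)
    finally have "g y = (d + fps_X * D z * e * c)
        + fps_X * (\<Sum>u\<in>W. (fps_X * D z * e * A u + D u) * g u)" .
    moreover have "rational_fps (d + fps_X * D z * e * c)"
      "\<And>u. rational_fps (fps_X * D z * e * A u + D u)"
      using c A d D e by (auto intro!: rational_fps_intros)
    ultimately show "\<exists>c A. rational_fps c \<and> (\<forall>u. rational_fps (A u)) \<and>
        g y = c + fps_X * (\<Sum>u\<in>W. A u * g u)"
      by (intro exI[of _ "d + fps_X * D z * e * c"]
          exI[of _ "\<lambda>u. fps_X * D z * e * A u + D u"]) blast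
  qed
  have "rational_fps (g z)"
    unfolding gz' using c A e ih by (intro rational_fps_intros rational_fps_sum)
  then show ?case
    using insert.prems(2) ih by auto
qed simp

text \<open>Iterating gives \<open>G k = Y^n * G (k + n)\<close>, so \<open>x^n\<close> divides
  \<open>G k\<close> for every \<open>n\<close>.\<close>

lemma fps_eq_0_if_divisible:
  fixes G :: "nat \<Rightarrow> 'a::idom fps"
  assumes "fps_nth Y 0 = 0" "\<And>k. G k = Y * G (Suc k)"
  shows "G k = 0"
proof -
  have "G k = Y ^ n * G (k + n)" for n
  proof (induction n)
    case (Suc n)
    then show ?case
      using assms(2)[of "k + n"] by (simp add: mult_ac)
  qed simp
  moreover have "fps_nth (Y ^ Suc n * H) n = 0" for n H
  proof -
    have "fps_nth (Y ^ Suc n) i = 0" if "i \<le> n" for i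
      using that startsby_zero_power_prefix[OF assms(1), of "Suc n"] by simp
    then show ?thesis
      unfolding fps_mult_nth by simp
  qed
  ultimately have "fps_nth (G k) n = 0" for n
    by metis
  then show ?thesis
    by (simp add: fps_eq_iff)
qed

section \<open>Sequences with rational generating function in a module\<close>

text \<open>A submodule over the ring of rational series, which appears only as the predicate
  \<open>rational_fps\<close>. Keeping \<open>M\<close> abstract separates the algebra from the
  generators chosen in the theorem.\<close>

locale rational_module =
  fixes M :: "'a::field fps set"
  assumes zero: "0 \<in> M"
    and add: "f \<in> M \<Longrightarrow> g \<in> M \<Longrightarrow> f + g \<in> M"
    and scale: "rational_fps c \<Longrightarrow> f \<in> M \<Longrightarrow> c * f \<in> M"
begin

lemma diff: "f \<in> M \<Longrightarrow> g \<in> M \<Longrightarrow> f - g \<in> M"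
  using add[OF _ scale[OF rational_fps_const[of "-1"]], of f g]
  by (simp flip: fps_const_neg)

lemma sum_mem: "(\<And>i. i \<in> I \<Longrightarrow> f i \<in> M) \<Longrightarrow> sum f I \<in> M"
  by (induction I rule: infinite_finite_induct) (auto intro: zero add)

lemma unit_cancel:
  assumes "rational_fps c" "fps_nth c 0 \<noteq> 0" "c * f \<in> M"
  shows "f \<in> M"
proof -
  have "inverse c * (c * f) = f"
    unfolding mult.assoc[symmetric] using assms(2) by (simp add: inverse_mult_eq_1)
  then show ?thesis
    using scale[OF rational_fps_inverse[OF assms(1,2)] assms(3)] by metis
qed

end

section \<open>Polynomials and rational series in the index variable \<open>y\<close>\<close>

definition rational_poly :: "'a::field fps poly \<Rightarrow> bool" where
  "rational_poly D \<longleftrightarrow> (\<forall>i. rational_fps (coeff D i))"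

lemma rational_polyD: "rational_poly D \<Longrightarrow> rational_fps (coeff D i)"
  by (simp add: rational_poly_def)

lemma rational_poly_0: "rational_poly 0"
  by (simp add: rational_poly_def rational_fps_0)

lemma rational_poly_pCons:
  "rational_fps a \<Longrightarrow> rational_poly D \<Longrightarrow> rational_poly (pCons a D)"
  by (auto simp: rational_poly_def coeff_pCons split: nat.splits)

lemma rational_poly_mult:
  "rational_poly D \<Longrightarrow> rational_poly E \<Longrightarrow> rational_poly (D * E)"
  unfolding rational_poly_def coeff_mult
  by (auto intro!: rational_fps_sum rational_fps_mult)

lemma rational_poly_eval:
  "rational_poly D \<Longrightarrow> rational_fps Y \<Longrightarrow> rational_fps (poly D Y)"
  unfolding poly_altdef
  by (auto intro!: rational_fps_sum rational_fps_intros rational_polyD)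

context rational_module
begin

definition module_poly :: "'a fps poly \<Rightarrow> bool" where
  "module_poly N \<longleftrightarrow> (\<forall>i. coeff N i \<in> M)"

lemma module_poly_mult: "rational_poly D \<Longrightarrow> module_poly N \<Longrightarrow> module_poly (D * N)"
  unfolding module_poly_def coeff_mult by (auto intro!: sum_mem scale rational_polyD)

lemma module_poly_add: "module_poly N \<Longrightarrow> module_poly N' \<Longrightarrow> module_poly (N + N')"
  by (simp add: module_poly_def add)

lemma module_poly_eval: "module_poly N \<Longrightarrow> rational_fps Y \<Longrightarrow> poly N Y \<in> M"
  unfolding poly_altdef module_poly_def
  by (subst mult.commute) (auto intro!: sum_mem scale rational_fps_power)

text \<open>
  The outer variable of \<open>F :: 'a fps fps\<close> marks the index of the sequence of its coefficients.
\<close>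

definition module_rational :: "'a fps fps \<Rightarrow> bool" where
  "module_rational F \<longleftrightarrow>
     (\<exists>D N. rational_poly D \<and> fps_nth (coeff D 0) 0 \<noteq> 0 \<and> module_poly N \<and>
        fps_of_poly D * F = fps_of_poly N)"

lemma module_rationalI:
  "rational_poly D \<Longrightarrow> fps_nth (coeff D 0) 0 \<noteq> 0 \<Longrightarrow> module_poly N \<Longrightarrow>
     fps_of_poly D * F = fps_of_poly N \<Longrightarrow> module_rational F"
  unfolding module_rational_def by blast

lemma module_rationalE:
  assumes "module_rational F"
  obtains D N where "rational_poly D" "fps_nth (coeff D 0) 0 \<noteq> 0" "module_poly N"
    "fps_of_poly D * F = fps_of_poly N"
  using assms unfolding module_rational_def by blast

lemma module_rational_0: "module_rational 0"
  by (rule module_rationalI[of "[:1:]" 0])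
    (auto simp: module_poly_def zero intro!: rational_poly_pCons rational_poly_0 rational_fps_1)

lemma module_rational_add:
  assumes "module_rational F" "module_rational G"
  shows "module_rational (F + G)"
proof -
  obtain D N E P where D: "rational_poly D" "fps_nth (coeff D 0) 0 \<noteq> 0" "module_poly N"
      "fps_of_poly D * F = fps_of_poly N"
    and E: "rational_poly E" "fps_nth (coeff E 0) 0 \<noteq> 0" "module_poly P"
      "fps_of_poly E * G = fps_of_poly P"
    using assms by (meson module_rationalE)
  have "fps_of_poly (D * E) * (F + G)
      = fps_of_poly E * (fps_of_poly D * F) + fps_of_poly D * (fps_of_poly E * G)"
    by (simp add: fps_of_poly_mult algebra_simps)
  also have "\<dots> = fps_of_poly (E * N + D * P)"
    by (simp add: D E fps_of_poly_mult fps_of_poly_add)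
  finally show ?thesis
    using D E
    by (intro module_rationalI[of "D * E" "E * N + D * P"])
      (auto simp: coeff_mult intro!: rational_poly_mult module_poly_add module_poly_mult)
qed

lemma module_rational_mult_poly:
  assumes "rational_poly P" "module_rational F"
  shows "module_rational (fps_of_poly P * F)"
proof -
  obtain D N where D: "rational_poly D" "fps_nth (coeff D 0) 0 \<noteq> 0" "module_poly N"
      "fps_of_poly D * F = fps_of_poly N"
    using assms by (meson module_rationalE)
  have "fps_of_poly D * (fps_of_poly P * F) = fps_of_poly (P * N)"
    by (simp add: fps_of_poly_mult mult.left_commute[of "fps_of_poly D"] D(4))
  then show ?thesis
    using D assms(1) by (intro module_rationalI[of D "P * N"]) (auto intro: module_poly_mult)
qed

lemma module_rational_cancel_poly:
  assumes "rational_poly P" "fps_nth (coeff P 0) 0 \<noteq> 0" "module_rational (fps_of_poly P * F)"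
  shows "module_rational F"
proof -
  obtain D N where D: "rational_poly D" "fps_nth (coeff D 0) 0 \<noteq> 0" "module_poly N"
      "fps_of_poly D * (fps_of_poly P * F) = fps_of_poly N"
    using assms by (meson module_rationalE)
  show ?thesis
    using D assms(1,2)
    by (intro module_rationalI[of "D * P" N])
      (auto simp: fps_of_poly_mult mult.assoc coeff_mult intro!: rational_poly_mult)
qed

lemma module_rational_scale:
  "rational_fps c \<Longrightarrow> module_rational F \<Longrightarrow> module_rational (fps_const c * F)"
  using module_rational_mult_poly[of "[:c:]" F]
  by (simp add: fps_of_poly_const rational_poly_pCons rational_poly_0)

lemma module_rational_cancel_scale:
  "rational_fps c \<Longrightarrow> fps_nth c 0 \<noteq> 0 \<Longrightarrow> module_rational (fps_const c * F) \<Longrightarrow> module_rational F"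
  using module_rational_cancel_poly[of "[:c:]" F]
  by (simp add: fps_of_poly_const rational_poly_pCons rational_poly_0)

text \<open>The constant coefficients in \<open>y\<close> satisfy \<open>D(0) F(0) = N(0)\<close>,
  and the unit \<open>D(0)\<close> can be cancelled.\<close>

lemma module_rational_nth_0:
  assumes "module_rational F"
  shows "fps_nth F 0 \<in> M"
proof -
  obtain D N where D: "rational_poly D" "fps_nth (coeff D 0) 0 \<noteq> 0" "module_poly N"
      "fps_of_poly D * F = fps_of_poly N"
    using assms by (meson module_rationalE)
  have "coeff D 0 * fps_nth F 0 = fps_nth (fps_of_poly D * F) 0"
    by simp
  also have "\<dots> \<in> M"
    using D(3) unfolding D(4) module_poly_def by simp
  finally show ?thesis
    using unit_cancel[OF rational_polyD[OF D(1)] D(2)] by blast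
qed

text \<open>Dropping \<open>F(0)\<close> and dividing by \<open>y\<close> keeps the denominator
  \<open>D\<close> and changes the numerator to \<open>(N - F(0) D) / y\<close>; its coefficients
  lie in \<open>M\<close> because \<open>F(0)\<close> does.\<close>

lemma module_rational_shift:
  assumes "module_rational F"
  shows "module_rational (fps_shift 1 F)"
proof -
  obtain D N where D: "rational_poly D" "fps_nth (coeff D 0) 0 \<noteq> 0" "module_poly N"
      "fps_of_poly D * F = fps_of_poly N"
    using assms by (meson module_rationalE)
  define P where "P = poly_shift 1 (N - smult (fps_nth F 0) D)"
  have "fps_of_poly D * fps_shift 1 F = fps_of_poly P"
  proof (rule fps_ext)
    fix n
    have F: "F = fps_const (fps_nth F 0) + fps_X * fps_shift 1 F"
      by (rule fps_ext) (simp add: fps_X_mult_nth)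
    have "fps_X * (fps_of_poly D * fps_shift 1 F)
        = fps_of_poly D * F - fps_const (fps_nth F 0) * fps_of_poly D"
      by (subst (2) F) (simp add: algebra_simps)
    also have "\<dots> = fps_of_poly (N - smult (fps_nth F 0) D)"
      by (simp add: D(4) fps_of_poly_diff fps_of_poly_smult)
    finally have "fps_nth (fps_X * (fps_of_poly D * fps_shift 1 F)) (Suc n)
        = coeff (N - smult (fps_nth F 0) D) (Suc n)"
      by simp
    then show "fps_nth (fps_of_poly D * fps_shift 1 F) n = fps_nth (fps_of_poly P) n"
      by (simp add: P_def coeff_poly_shift)
  qed
  moreover have "module_poly P"
    using D(1,3) module_rational_nth_0[OF assms]
    unfolding P_def module_poly_def coeff_poly_shift
    by (auto simp: mult.commute[of "fps_nth F 0"] intro!: diff scale rational_polyD)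
  ultimately show ?thesis
    using D(1,2) by (blast intro: module_rationalI)
qed

lemma module_rational_shiftn: "module_rational F \<Longrightarrow> module_rational (fps_shift n F)"
proof (induction n)
  case (Suc n)
  then have "module_rational (fps_shift 1 (fps_shift n F))"
    by (intro module_rational_shift) simp
  moreover have "fps_shift 1 (fps_shift n F) = fps_shift (Suc n) F"
    by (simp add: fps_eq_iff)
  ultimately show ?case
    by simp
qed simp

lemma module_rational_nth: "module_rational F \<Longrightarrow> fps_nth F n \<in> M"
  using module_rational_nth_0[OF module_rational_shiftn, of F n] by simp

text \<open>Multiplication by \<open>1 - y\<close> undoes the summation; the factor \<open>y\<close>
  on the other side arises because the sum stops before \<open>k\<close>.\<close>

lemma module_rational_prefix_sums:
  assumes "module_rational (Abs_fps f)"
  shows "module_rational (Abs_fps (\<lambda>k. \<Sum>i<k. f i))"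
proof (rule module_rational_cancel_poly[of "[:1, -1:]"])
  have "fps_of_poly [:1, -1:] * Abs_fps (\<lambda>k. \<Sum>i<k. f i) = fps_of_poly [:0, 1:] * Abs_fps f"
    by (rule fps_ext, case_tac n)
      (simp_all add: fps_of_poly_pCons algebra_simps fps_X_mult_nth)
  then show "module_rational (fps_of_poly [:1, -1:] * Abs_fps (\<lambda>k. \<Sum>i<k. f i))"
    unfolding \<open>fps_of_poly [:1, -1:] * _ = _\<close> using assms
    by (intro module_rational_mult_poly rational_poly_pCons rational_poly_0
        rational_fps_0 rational_fps_1)
qed (auto intro!: rational_poly_pCons rational_poly_0 rational_fps_intros)

text \<open>Transfers a rational generating function over the field to the outer variable
  \<open>y\<close>: its numerator and denominator keep their form when their coefficients are read
  as constant series in \<open>x\<close>.\<close>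

lemma module_rational_scalar_seq:
  assumes "rational_fps (Abs_fps p)" "g \<in> M"
  shows "module_rational (Abs_fps (\<lambda>k. fps_const (p k) * g))"
proof -
  obtain a b where ab: "poly b 0 \<noteq> 0" "Abs_fps p * fps_of_poly b = fps_of_poly a"
    using assms(1) unfolding rational_fps_iff by blast
  show ?thesis
  proof (rule module_rationalI[of "map_poly fps_const b" "smult g (map_poly fps_const a)"])
    show "rational_poly (map_poly fps_const b)"
      by (simp add: rational_poly_def coeff_map_poly rational_fps_const)
    show "fps_nth (coeff (map_poly fps_const b) 0) 0 \<noteq> 0"
      using ab(1) by (simp add: coeff_map_poly poly_0_coeff_0)
    show "module_poly (smult g (map_poly fps_const a))"
      using scale[OF rational_fps_const assms(2)]
      by (simp add: module_poly_def coeff_map_poly mult.commute[of g])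
    show "fps_of_poly (map_poly fps_const b) * Abs_fps (\<lambda>k. fps_const (p k) * g)
        = fps_of_poly (smult g (map_poly fps_const a))"
    proof (rule fps_ext)
      fix n
      have sum: "(\<Sum>i\<in>I. fps_const (h i)) = fps_const (\<Sum>i\<in>I. h i)"
        for h :: "nat \<Rightarrow> 'a" and I
        by (induction I rule: infinite_finite_induct) auto
      have "fps_nth (fps_of_poly (map_poly fps_const b) * Abs_fps (\<lambda>k. fps_const (p k) * g)) n
          = (\<Sum>i=0..n. fps_const (coeff b i * p (n - i))) * g"
        by (simp add: fps_mult_nth coeff_map_poly sum_distrib_right mult.assoc
            flip: fps_const_mult)
      also have "\<dots> = fps_const (fps_nth (fps_of_poly b * Abs_fps p) n) * g"
        by (simp add: sum fps_mult_nth)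
      also have "\<dots> = fps_const (coeff a n) * g"
        using ab(2) by (simp add: mult.commute)
      finally show "fps_nth (fps_of_poly (map_poly fps_const b) *
          Abs_fps (\<lambda>k. fps_const (p k) * g)) n
          = fps_nth (fps_of_poly (smult g (map_poly fps_const a))) n"
        by (simp add: coeff_map_poly mult.commute)
    qed
  qed
qed

lemma module_rational_const:
  assumes "g \<in> M"
  shows "module_rational (Abs_fps (\<lambda>_. g))"
proof (rule module_rational_cancel_poly[of "[:1, -1:]"])
  have eq: "fps_of_poly [:1, -1:] * Abs_fps (\<lambda>_. g) = fps_of_poly [:g:]"
    by (rule fps_ext, case_tac n)
      (simp_all add: fps_of_poly_pCons algebra_simps fps_X_mult_nth)
  have "module_poly [:g:]"
    using assms zero by (auto simp: module_poly_def coeff_pCons split: nat.splits)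
  then show "module_rational (fps_of_poly [:1, -1:] * Abs_fps (\<lambda>_. g))"
    unfolding eq
    by (intro module_rationalI[of "[:1:]"])
      (auto intro!: rational_poly_pCons rational_poly_0 rational_fps_intros)
qed (auto intro!: rational_poly_pCons rational_poly_0 rational_fps_intros)

text \<open>
  The kernel method: with \<open>D u = N\<close> the recurrence says that \<open>(y - Y) D f = y N - Y f\<^sub>0 D\<close>, the
  series \<open>D f\<close> is a polynomial because \<open>Y\<close> is topologically nilpotent, and setting \<open>y = Y\<close>
  gives \<open>f\<^sub>0 = N(Y) / D(Y)\<close>.
\<close>

lemma kernel_method_0:
  assumes u: "module_rational (Abs_fps u)"
    and Y: "rational_fps Y" "fps_nth Y 0 = 0"
    and rec: "\<And>k. f k = u k + Y * f (Suc k)"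
  shows "f 0 \<in> M"
proof (cases "Y = 0")
  \<comment> \<open>The factor \<open>Y\<close> is cancelled at the end of the other case; if it
    vanishes, the recurrence reads \<open>f 0 = u 0\<close>.\<close>
  case True
  then show ?thesis
    using rec[of 0] module_rational_nth_0[OF u] by simp
next
  case False
  obtain D N where D: "rational_poly D" "fps_nth (coeff D 0) 0 \<noteq> 0" "module_poly N"
      "fps_of_poly D * Abs_fps u = fps_of_poly N"
    using u by (meson module_rationalE)
  define G where "G = fps_of_poly D * Abs_fps f"
  define R where "R = pCons 0 N - smult (Y * f 0) D"
  have "(fps_X - fps_const Y) * Abs_fps f = fps_X * Abs_fps u - fps_const (Y * f 0)"
  proof (rule fps_ext)
    fix n
    show "fps_nth ((fps_X - fps_const Y) * Abs_fps f) n
        = fps_nth (fps_X * Abs_fps u - fps_const (Y * f 0)) n"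
      using rec[of "n - 1"] by (cases n) (simp_all add: algebra_simps fps_X_mult_nth)
  qed
  then have "fps_of_poly D * ((fps_X - fps_const Y) * Abs_fps f)
      = fps_of_poly D * (fps_X * Abs_fps u - fps_const (Y * f 0))"
    by simp
  then have GR: "(fps_X - fps_const Y) * G = fps_of_poly R"
    using D(4)
    by (simp add: G_def R_def fps_of_poly_diff fps_of_poly_smult fps_of_poly_pCons algebra_simps)
  \<comment> \<open>Comparison of the coefficients at \<open>y^(k+1)\<close>, which exceeds the
    degree of \<open>R\<close>. The tail of \<open>G\<close> is thus divisible by every power of
    \<open>Y\<close>, hence zero.\<close>
  have step: "fps_nth G k = Y * fps_nth G (Suc k)" if "k \<ge> degree R" for k
  proof -
    have "fps_nth ((fps_X - fps_const Y) * G) (Suc k) = 0"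
      unfolding GR using that by (simp add: coeff_eq_0)
    then show ?thesis
      by (simp add: algebra_simps fps_X_mult_nth)
  qed
  have G0: "fps_nth G k = 0" if "k \<ge> degree R" for k
  proof -
    have "fps_nth G (k + i) = Y * fps_nth G (k + Suc i)" for i
      using step[of "k + i"] that by simp
    from fps_eq_0_if_divisible[of Y "\<lambda>i. fps_nth G (k + i)", OF Y(2) this, of 0] show ?thesis
      by simp
  qed
  \<comment> \<open>\<open>g\<close> is \<open>G\<close> cut off at \<open>degree R\<close>, from
    where on all coefficients vanish; as a polynomial it can be evaluated at
    \<open>y = Y\<close>.\<close>
  define g where "g = poly_of_list (map (fps_nth G) [0..<degree R])"
  have gG: "fps_of_poly g = G"
    using G0 by (auto simp: fps_eq_iff g_def nth_default_def)
  have lin: "fps_of_poly [:- Y, 1:] = fps_X - fps_const Y"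
    by (simp add: fps_of_poly_pCons)
  have "fps_of_poly ([:- Y, 1:] * g) = fps_of_poly R"
    unfolding fps_of_poly_mult gG lin by (rule GR)
  then have "[:- Y, 1:] * g = R"
    by (simp only: fps_of_poly_eq_iff)
  then have "poly R Y = poly ([:- Y, 1:] * g) Y"
    by simp
  also have "\<dots> = 0"
    by (simp only: poly_mult) simp
  finally have "poly R Y = 0" .
  then have "poly N Y = poly D Y * f 0"
    using False by (simp add: R_def mult_ac)
  then have "poly D Y * f 0 \<in> M"
    using module_poly_eval[OF D(3) Y(1)] by metis
  \<comment> \<open>Since \<open>Y\<close> has constant term 0, \<open>D(Y)\<close> has the same
    constant term as \<open>D(0)\<close>.\<close>
  moreover have "fps_nth (poly D Y) 0 \<noteq> 0"
  proof -
    obtain a E where "D = pCons a E"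
      by (cases D)
    then show ?thesis
      using D(2) Y(2) by simp
  qed
  ultimately show ?thesis
    using unit_cancel rational_poly_eval[OF D(1) Y(1)] by blast
qed

text \<open>Hypothesis and recurrence are stable under shifting the index, which moves term
  \<open>n\<close> to position 0.\<close>

lemma kernel_method:
  assumes "module_rational (Abs_fps u)" "rational_fps Y" "fps_nth Y 0 = 0"
    and "\<And>k. f k = u k + Y * f (Suc k)"
  shows "f n \<in> M"
proof -
  have "fps_shift n (Abs_fps u) = Abs_fps (\<lambda>k. u (k + n))"
    by (simp add: fps_eq_iff)
  then have "module_rational (Abs_fps (\<lambda>k. u (k + n)))"
    using module_rational_shiftn[OF assms(1), of n] by simp
  from kernel_method_0[OF this assms(2,3), of "\<lambda>k. f (k + n)"] show ?thesis
    using assms(4)[of "_ + n"] by (metis add_0 add_Suc)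
qed

end

section \<open>Sequences governed by the succession rules\<close>

context rational_module
begin

lemma module_rational_add_seq:
  "module_rational (Abs_fps f) \<Longrightarrow> module_rational (Abs_fps g) \<Longrightarrow>
     module_rational (Abs_fps (\<lambda>k. f k + g k))"
  using module_rational_add[of "Abs_fps f" "Abs_fps g"] by (simp add: fps_plus_def)

lemma module_rational_scale_seq:
  "rational_fps c \<Longrightarrow> module_rational (Abs_fps f) \<Longrightarrow> module_rational (Abs_fps (\<lambda>k. c * f k))"
proof -
  have "fps_const c * Abs_fps f = Abs_fps (\<lambda>k. c * f k)"
    by (simp add: fps_eq_iff)
  then show "rational_fps c \<Longrightarrow> module_rational (Abs_fps f) \<Longrightarrow>
      module_rational (Abs_fps (\<lambda>k. c * f k))"
    using module_rational_scale by metis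
qed

lemma module_rational_sum_seq:
  "(\<And>i. i \<in> I \<Longrightarrow> module_rational (Abs_fps (f i))) \<Longrightarrow>
     module_rational (Abs_fps (\<lambda>k. \<Sum>i\<in>I. f i k))"
proof (induction I rule: infinite_finite_induct)
  case (insert i I)
  then show ?case
    using module_rational_add_seq[of "f i" "\<lambda>k. \<Sum>i\<in>I. f i k"] by simp
qed (use module_rational_0 in \<open>simp_all add: fps_zero_def\<close>)

lemma module_rational_Suc_seq:
  assumes "module_rational (Abs_fps f)"
  shows "module_rational (Abs_fps (\<lambda>k. f (Suc k)))"
proof -
  have "fps_shift 1 (Abs_fps f) = Abs_fps (\<lambda>k. f (Suc k))"
    by (simp add: fps_eq_iff)
  then show ?thesis
    using module_rational_shift[OF assms] by simp
qed

lemmas module_rational_seq_intros =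
  module_rational_add_seq module_rational_scale_seq module_rational_sum_seq
  module_rational_prefix_sums

text \<open>Handles loops at a node: the term in \<open>f k\<close> moves to the left, where its
  factor \<open>1 - x c\<close> is a unit not involving \<open>y\<close>.\<close>

lemma module_rational_implicit:
  assumes u: "module_rational (Abs_fps u)" and c: "rational_fps c"
    and rec: "\<And>k. f k = u k + fps_X * (c * f k)"
  shows "module_rational (Abs_fps f)"
proof (rule module_rational_cancel_scale[of "1 - fps_X * c"])
  have "(1 - fps_X * c) * f k = u k" for k
    using rec[of k] by (simp add: algebra_simps)
  then have "fps_const (1 - fps_X * c) * Abs_fps f = Abs_fps u"
    by (simp add: fps_eq_iff del: fps_const_sub)
  then show "module_rational (fps_const (1 - fps_X * c) * Abs_fps f)"
    using u by simp
qed (use c in \<open>auto intro!: rational_fps_intros\<close>)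

text \<open>The shape of the rule for the first path. Subtracting the recurrences at consecutive
  indices removes the prefix sum and leaves a two-term recurrence.\<close>

lemma module_rational_cumulative:
  assumes h: "module_rational (Abs_fps h)" and c: "rational_fps c"
    and rec: "\<And>k. f k = h k + fps_X * ((\<Sum>i<k. f i) + c * f k)"
  shows "module_rational (Abs_fps f)"
\<comment> \<open>The two coefficients are those of \<open>f (Suc k)\<close> and \<open>f k\<close>
  in the subtracted recurrence; the first is a unit.\<close>
proof (rule module_rational_cancel_poly[of "[:1 - fps_X * c, fps_X * c - 1 - fps_X:]"])
  have step: "f (Suc k) - f k = h (Suc k) - h k + fps_X * (f k + c * f (Suc k) - c * f k)" for k
  proof -
    have "f (Suc k) - f k
        = (h (Suc k) + fps_X * ((\<Sum>i<Suc k. f i) + c * f (Suc k)))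
          - (h k + fps_X * ((\<Sum>i<k. f i) + c * f k))"
      by (simp only: rec[symmetric])
    then show ?thesis
      by (simp add: algebra_simps)
  qed
  have "fps_of_poly [:1 - fps_X * c, fps_X * c - 1 - fps_X:] * Abs_fps f
      = fps_of_poly [:1, -1:] * Abs_fps h"
  proof (rule fps_ext)
    fix n
    have lin: "fps_nth (fps_of_poly [:a, b:] * F) n
        = a * fps_nth F n + (if n = 0 then 0 else b * fps_nth F (n - 1))"
      for a b :: "'a fps" and F
      by (simp add: fps_of_poly_pCons distrib_right mult.assoc fps_X_mult_nth)
    show "fps_nth (fps_of_poly [:1 - fps_X * c, fps_X * c - 1 - fps_X:] * Abs_fps f) n
        = fps_nth (fps_of_poly [:1, -1:] * Abs_fps h) n"
    proof (cases n)
      case 0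
      then show ?thesis
        using rec[of 0] unfolding lin by (simp add: algebra_simps)
    next
      case (Suc k)
      then show ?thesis
        using step[of k] unfolding lin by (simp add: algebra_simps)
    qed
  qed
  then show "module_rational
      (fps_of_poly [:1 - fps_X * c, fps_X * c - 1 - fps_X:] * Abs_fps f)"
    using h by (auto simp del: fps_of_poly_pCons
        intro!: module_rational_mult_poly rational_poly_pCons rational_poly_0 rational_fps_intros)
qed (use c in \<open>auto intro!: rational_poly_pCons rational_poly_0 rational_fps_intros\<close>)

text \<open>The shape of the rule for the last path when \<open>\<alpha> \<ge> 2\<close>. Division
  by the unit \<open>1 - x c\<close> prepares the kernel method with \<open>Y = e x d\<close>, whose
  constant term is 0.\<close>

lemma mem_if_growing:
  assumes u: "module_rational (Abs_fps u)" and c: "rational_fps c" "rational_fps d"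
    and rec: "\<And>k. f k = u k + fps_X * (c * f k + d * f (Suc k))"
  shows "f n \<in> M"
proof -
  define e where "e = inverse (1 - fps_X * c)"
  have e: "rational_fps e"
    unfolding e_def using c by (auto intro!: rational_fps_inverse rational_fps_intros)
  have inv: "e * (1 - fps_X * c) = 1"
    unfolding e_def by (rule inverse_mult_eq_1) simp
  have eq: "f k = e * u k + (e * fps_X * d) * f (Suc k)" for k
  proof -
    have "(1 - fps_X * c) * f k = u k + fps_X * d * f (Suc k)"
      using rec[of k] by (simp add: algebra_simps)
    then have "e * (1 - fps_X * c) * f k = e * (u k + fps_X * d * f (Suc k))"
      by (simp only: mult.assoc)
    then show ?thesis
      unfolding inv by (simp add: algebra_simps)
  qed
  show ?thesis
  proof (rule kernel_method[where f = f])
    show "f k = e * u k + (e * fps_X * d) * f (Suc k)" for k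
      by (rule eq)
    show "module_rational (Abs_fps (\<lambda>k. e * u k))"
      using e u by (rule module_rational_scale_seq)
    show "rational_fps (e * fps_X * d)"
      using e c by (intro rational_fps_intros)
  qed simp
qed

end

lemma rational_module_span:
  fixes g :: "'b \<Rightarrow> 'a::field fps"
  shows "rational_module {c + (\<Sum>w\<in>W. A w * g w) | c A. rational_fps c \<and> (\<forall>w. rational_fps (A w))}"
    (is "rational_module ?M")
proof
  show "0 \<in> ?M"
    by (auto intro!: exI[of _ 0] exI[of _ "\<lambda>_. 0"] rational_fps_0)
next
  fix f f' assume "f \<in> ?M" "f' \<in> ?M"
  then obtain c A c' A' where f: "f = c + (\<Sum>w\<in>W. A w * g w)" "rational_fps c"
      "\<And>w. rational_fps (A w)"
    and f': "f' = c' + (\<Sum>w\<in>W. A' w * g w)" "rational_fps c'" "\<And>w. rational_fps (A' w)"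
    by blast
  have "f + f' = (c + c') + (\<Sum>w\<in>W. (A w + A' w) * g w)"
    by (simp add: f(1) f'(1) algebra_simps sum.distrib)
  moreover have "rational_fps (c + c')" "\<And>w. rational_fps (A w + A' w)"
    using f f' by (auto intro: rational_fps_add)
  ultimately show "f + f' \<in> ?M"
    by (intro CollectI exI[of _ "c + c'"] exI[of _ "\<lambda>w. A w + A' w"]) blast
next
  fix d f :: "'a fps" assume d: "rational_fps d" and "f \<in> ?M"
  then obtain c A where f: "f = c + (\<Sum>w\<in>W. A w * g w)" "rational_fps c"
      "\<And>w. rational_fps (A w)"
    by blast
  have "d * f = d * c + (\<Sum>w\<in>W. (d * A w) * g w)"
    by (simp add: f(1) algebra_simps sum_distrib_left)
  moreover have "rational_fps (d * c)" "\<And>w. rational_fps (d * A w)"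
    using f d by (auto intro: rational_fps_mult)
  ultimately show "d * f \<in> ?M"
    by (intro CollectI exI[of _ "d * c"] exI[of _ "\<lambda>w. d * A w"]) blast
qed

section \<open>Levels of the pattern-avoidance tree\<close>

lemma finite_perms_of_length: "finite (perms_of_length n)"
  unfolding perms_of_length_def by simp

lemma length_perms_of_length: "\<pi> \<in> perms_of_length n \<Longrightarrow> length \<pi> = n"
  unfolding perms_of_length_def by (auto dest: length_finite_permutations_of_set)

lemma avoiders_iff: "\<pi> \<in> avoiders B \<longleftrightarrow> length \<pi> \<ge> 1 \<and> \<pi> \<in> avoiders_of_length (length \<pi>) B"
  unfolding avoiders_def avoiders_of_length_def
  by (auto dest: length_perms_of_length)

lemma length_avoiders_of_length: "\<pi> \<in> avoiders_of_length n B \<Longrightarrow> length \<pi> = n"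
  unfolding avoiders_of_length_def by (auto dest: length_perms_of_length)

text \<open>Moving the positions from the inserted letter on by one preserves their order and the
  letters found there.\<close>

lemma contains_remove:
  assumes "contains (xs @ ys) \<tau>"
  shows "contains (xs @ a # ys) \<tau>"
proof -
  obtain f where f: "strict_mono_on {..<length \<tau>} f" "f ` {..<length \<tau>} \<subseteq> {..<length (xs @ ys)}"
    "\<And>a b. a < length \<tau> \<Longrightarrow> b < length \<tau> \<Longrightarrow> (xs @ ys) ! f a < (xs @ ys) ! f b \<longleftrightarrow> \<tau> ! a < \<tau> ! b"
    using assms unfolding contains_def by blast
  define g where "g i = (if i < length xs then i else Suc i)" for i
  have nth: "(xs @ a # ys) ! g i = (xs @ ys) ! i" for i
    by (simp add: g_def nth_append Suc_diff_le)
  have "strict_mono_on {..<length \<tau>} (g \<circ> f)"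
    using f(1) by (fastforce simp: strict_mono_on_def g_def)
  moreover have "(g \<circ> f) ` {..<length \<tau>} \<subseteq> {..<length (xs @ a # ys)}"
    using f(2) by (force simp: g_def)
  ultimately show ?thesis
    unfolding contains_def using f(3) nth by (intro exI[of _ "g \<circ> f"]) simp
qed

text \<open>A pattern occurring in the parent also occurs in \<open>\<pi>\<close>, where only a
  letter is inserted.\<close>

lemma parent_avoider:
  assumes "\<pi> \<in> avoiders_of_length (Suc n) B"
  shows "parent \<pi> \<in> avoiders_of_length n B"
proof -
  have set: "set \<pi> = {1..Suc n}" and dist: "distinct \<pi>"
    and av: "\<And>\<tau>. \<tau> \<in> B \<Longrightarrow> \<not> contains \<pi> \<tau>"
    using assms by (auto simp: avoiders_of_length_def perms_of_length_def permutations_of_set_def)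
  have len: "length \<pi> = Suc n"
    using assms by (rule length_avoiders_of_length)
  have "Suc n \<in> set \<pi>"
    by (simp add: set)
  then obtain xs ys where \<pi>: "\<pi> = xs @ Suc n # ys"
    by (auto dest: split_list)
  have "Suc n \<notin> set xs \<union> set ys"
    using dist \<pi> by auto
  then have p: "parent \<pi> = xs @ ys"
    unfolding parent_def len using \<pi> by simp
  have "set (xs @ ys) = set \<pi> - {Suc n}"
    using \<open>Suc n \<notin> _\<close> \<pi> by auto
  also have "\<dots> = {1..n}"
    unfolding set by (auto simp: le_Suc_eq)
  finally have "parent \<pi> \<in> perms_of_length n"
    using dist unfolding p perms_of_length_def
    by (intro permutations_of_setI) (auto simp: \<pi>)
  moreover have "\<not> contains (parent \<pi>) \<tau>" if "\<tau> \<in> B" for \<tau>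
    using av[OF that] contains_remove[of xs ys \<tau> "Suc n"] unfolding p by (auto simp: \<pi>)
  ultimately show ?thesis
    by (simp add: avoiders_of_length_def)
qed

lemma tree_edges_iff:
  "(\<sigma>, \<pi>) \<in> tree_edges B \<longleftrightarrow> \<sigma> = parent \<pi> \<and> \<pi> \<in> avoiders B \<and> length \<pi> \<ge> 2"
  unfolding tree_edges_def by auto

lemma tree_edge_avoiders:
  assumes "(\<sigma>, \<pi>) \<in> tree_edges B"
  shows "\<sigma> \<in> avoiders B" "\<pi> \<in> avoiders B" "length \<pi> = Suc (length \<sigma>)"
proof -
  have \<pi>: "\<sigma> = parent \<pi>" "\<pi> \<in> avoiders B" "length \<pi> \<ge> 2"
    using assms by (auto simp: tree_edges_iff)
  then obtain n where n: "length \<pi> = Suc n" "n \<ge> 1"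
    by (cases "length \<pi>") auto
  then have "\<sigma> \<in> avoiders_of_length n B"
    using \<pi> parent_avoider by (simp add: avoiders_iff)
  then have "length \<sigma> = n"
    by (rule length_avoiders_of_length)
  then show "\<sigma> \<in> avoiders B" "\<pi> \<in> avoiders B" "length \<pi> = Suc (length \<sigma>)"
    using \<open>\<sigma> \<in> avoiders_of_length n B\<close> n \<pi> by (auto simp: avoiders_iff)
qed

section \<open>Counting descendants by depth\<close>

definition level :: "perm set \<Rightarrow> perm \<Rightarrow> nat \<Rightarrow> perm set" where
  "level B \<pi> n = (tree_edges B ^^ n) `` {\<pi>}"

text \<open>The series \<open>F\<^sub>\<pi>\<close>. Depth starts at 0 whereas \<open>[1]\<close>
  has length 1, whence the factor \<open>x\<close> in \<open>avoiders_gf_eq\<close>.\<close>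

definition subtree_gf :: "perm set \<Rightarrow> perm \<Rightarrow> 'a::field_char_0 fps" where
  "subtree_gf B \<pi> = Abs_fps (\<lambda>n. of_nat (card (level B \<pi> n)))"

lemma level_0: "level B \<pi> 0 = {\<pi>}"
  by (simp add: level_def)

lemma level_Suc: "level B \<pi> (Suc n) = tree_edges B `` level B \<pi> n"
  by (auto simp: level_def)

text \<open>Splits off the first edge of a path instead of the last, as the recursion over children
  requires.\<close>

lemma level_Suc': "level B \<pi> (Suc n) = (\<Union>c\<in>children B \<pi>. level B c n)"
  unfolding level_def children_def relpow.simps relpow_commute[symmetric] by blast

lemma children_subset: "children B \<pi> \<subseteq> avoiders_of_length (Suc (length \<pi>)) B"
  using tree_edge_avoiders[of \<pi> _ B] by (fastforce simp: children_def avoiders_iff)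

lemma finite_avoiders_of_length: "finite (avoiders_of_length n B)"
  unfolding avoiders_of_length_def using finite_perms_of_length by simp

lemma finite_children: "finite (children B \<pi>)"
  using children_subset finite_avoiders_of_length by (rule finite_subset)

lemma children_avoiders: "c \<in> children B \<pi> \<Longrightarrow> c \<in> avoiders B"
  using tree_edge_avoiders(2) by (auto simp: children_def)

lemma finite_level: "finite (level B \<pi> n)"
  by (induction n)
    (auto simp: level_0 level_Suc Image_eq_UN[of _ "level _ _ _"] finite_children
      children_def[symmetric])

text \<open>Parents are unique, so going up \<open>n\<close> steps from \<open>x\<close> ends in a
  single vertex.\<close>

lemma level_disjoint:
  assumes "x \<in> level B c n" "x \<in> level B d n"
  shows "c = d"
  using assms
proof (induction n arbitrary: x)
  case (Suc n)
  then obtain y z where "y \<in> level B c n" "(y, x) \<in> tree_edges B"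
    "z \<in> level B d n" "(z, x) \<in> tree_edges B"
    unfolding level_Suc by blast
  moreover from this have "y = z"
    by (simp add: tree_edges_iff)
  ultimately show ?case
    using Suc.IH by blast
qed (simp add: level_0)

text \<open>Every descendant other than \<open>\<pi>\<close> lies below exactly one child, at depth
  one less.\<close>

lemma subtree_gf_rec:
  "(subtree_gf B \<pi> :: 'a::field_char_0 fps)
     = 1 + fps_X * (\<Sum>c\<in>children B \<pi>. subtree_gf B c)"
proof (rule fps_ext)
  fix n
  have "card (\<Union>c\<in>children B \<pi>. level B c k) = (\<Sum>c\<in>children B \<pi>. card (level B c k))" for k
    using level_disjoint by (intro card_UN_disjoint finite_children) (auto simp: finite_level)
  then show "fps_nth (subtree_gf B \<pi> :: 'a fps) n
      = fps_nth (1 + fps_X * (\<Sum>c\<in>children B \<pi>. subtree_gf B c)) n"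
    by (cases n) (simp_all add: subtree_gf_def level_0 level_Suc' fps_X_mult_nth fps_sum_nth)
qed

lemma level_subtree: "level B \<pi> n \<subseteq> subtree B \<pi>"
  by (auto simp: level_def subtree_def dest: relpow_imp_rtrancl)

text \<open>An isomorphism fixes the roots and respects edges in both directions, so by induction it
  maps each level onto the corresponding level.\<close>

lemma subtree_gf_equiv:
  assumes "tree_equiv B \<pi> \<pi>'"
  shows "subtree_gf B \<pi> = subtree_gf B \<pi>'"
proof -
  obtain f where f: "bij_betw f (subtree B \<pi>) (subtree B \<pi>')" "f \<pi> = \<pi>'"
    and e: "\<And>x y. x \<in> subtree B \<pi> \<Longrightarrow> y \<in> subtree B \<pi> \<Longrightarrow>
       (x, y) \<in> tree_edges B \<longleftrightarrow> (f x, f y) \<in> tree_edges B"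
    using assms unfolding tree_equiv_def by blast
  have img: "f ` level B \<pi> n = level B \<pi>' n" for n
  proof (induction n)
    case (Suc n)
    show ?case
    proof (intro equalityI subsetI)
      fix z assume "z \<in> f ` level B \<pi> (Suc n)"
      then obtain x y where "z = f y" "x \<in> level B \<pi> n" "(x, y) \<in> tree_edges B"
          "y \<in> level B \<pi> (Suc n)"
        unfolding level_Suc by blast
      then have "f x \<in> level B \<pi>' n" "(f x, z) \<in> tree_edges B"
        using e[of x y] subsetD[OF level_subtree, of x B \<pi> n]
          subsetD[OF level_subtree, of y B \<pi> "Suc n"] Suc by auto
      then show "z \<in> level B \<pi>' (Suc n)"
        unfolding level_Suc by blast
    next
      fix z assume z: "z \<in> level B \<pi>' (Suc n)"
      then obtain x where x: "x \<in> level B \<pi> n" "(f x, z) \<in> tree_edges B"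
        unfolding level_Suc Suc[symmetric] by blast
      \<comment> \<open>Surjectivity is available on the whole subtree only; the edge from
        \<open>x\<close> then places \<open>y\<close> on the right level.\<close>
      obtain y where y: "y \<in> subtree B \<pi>" "z = f y"
        using subsetD[OF level_subtree z] bij_betw_imp_surj_on[OF f(1)] by blast
      then have "(x, y) \<in> tree_edges B"
        using e[of x y] x subsetD[OF level_subtree x(1)] by simp
      then have "y \<in> level B \<pi> (Suc n)"
        using x(1) unfolding level_Suc by (rule ImageI)
      then show "z \<in> f ` level B \<pi> (Suc n)"
        unfolding y(2) by (rule imageI)
    qed
  qed (simp add: level_0 f(2))
  have "card (level B \<pi> n) = card (level B \<pi>' n)" for n
    using card_image[of f "level B \<pi> n"] img f(1) level_subtree
    by (metis bij_betw_def inj_on_subset)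
  then show ?thesis
    by (simp add: subtree_gf_def)
qed

section \<open>The root of the tree\<close>

lemma perms_of_length_1: "perms_of_length (Suc 0) = {[1]}"
  by (simp add: perms_of_length_def permutations_of_set_singleton)

text \<open>A pattern contained in \<open>[1]\<close> has length at most 1.
  \<open>B \<subseteq> perms\<close> rules out the empty pattern, which every permutation
  contains.\<close>

lemma avoiders_of_length_1:
  assumes "B \<subseteq> perms" "[1] \<notin> B"
  shows "avoiders_of_length (Suc 0) B = {[1]}"
proof -
  have "\<not> contains [1] \<tau>" if "\<tau> \<in> B" for \<tau>
  proof
    assume "contains [1] \<tau>"
    then obtain f where "strict_mono_on {..<length \<tau>} f" "f ` {..<length \<tau>} \<subseteq> {..<Suc 0}"
      unfolding contains_def by auto
    then have "card {..<length \<tau>} \<le> card {..<Suc 0}"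
      by (metis card_inj_on_le finite_lessThan strict_mono_on_imp_inj_on)
    moreover obtain n where n: "n \<ge> 1" "\<tau> \<in> perms_of_length n"
      using assms(1) \<open>\<tau> \<in> B\<close> unfolding perms_def by auto
    ultimately have "n = Suc 0"
      using length_perms_of_length[of \<tau> n] by simp
    then show False
      using n perms_of_length_1 \<open>\<tau> \<in> B\<close> assms(2) by simp
  qed
  then show ?thesis
    by (auto simp: avoiders_of_length_def perms_of_length_1)
qed

text \<open>Deleting the largest letter again and again leads from any avoider down to
  \<open>[1]\<close> without leaving the avoiders.\<close>

lemma level_root:
  assumes "B \<subseteq> perms" "[1] \<notin> B"
  shows "level B [1] n = avoiders_of_length (Suc n) B"
proof (induction n)
  case 0
  then show ?case
    using avoiders_of_length_1[OF assms] by (simp add: level_0)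
next
  case (Suc n)
  show ?case
    unfolding level_Suc Suc
  proof (intro equalityI subsetI)
    fix z assume "z \<in> tree_edges B `` avoiders_of_length (Suc n) B"
    then obtain y where y: "(y, z) \<in> tree_edges B" "y \<in> avoiders_of_length (Suc n) B"
      by blast
    then show "z \<in> avoiders_of_length (Suc (Suc n)) B"
      using tree_edge_avoiders[OF y(1)] length_avoiders_of_length[OF y(2)]
      by (simp add: avoiders_iff)
  next
    fix z assume z: "z \<in> avoiders_of_length (Suc (Suc n)) B"
    then have "(parent z, z) \<in> tree_edges B"
      using length_avoiders_of_length[OF z] by (simp add: tree_edges_iff avoiders_iff)
    then show "z \<in> tree_edges B `` avoiders_of_length (Suc n) B"
      using parent_avoider[OF z] by blast
  qed
qed

lemma avoiders_gf_eq:
  assumes "B \<subseteq> perms" "[1] \<notin> B"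
  shows "avoiders_gf B = fps_X * subtree_gf B [1]"
proof (rule fps_ext)
  fix n
  show "fps_nth (avoiders_gf B) n = fps_nth (fps_X * subtree_gf B [1]) n"
    using level_root[OF assms, of "n - 1"]
    by (cases n) (simp_all add: avoiders_gf_def subtree_gf_def fps_X_mult_nth)
qed

section \<open>Succession rules\<close>

lemma rep_node: "labelling B rep \<Longrightarrow> w \<in> nodes B rep \<Longrightarrow> rep w = w"
  unfolding nodes_def labelling_def by blast

lemma node_avoider: "labelling B rep \<Longrightarrow> w \<in> nodes B rep \<Longrightarrow> w \<in> avoiders B"
  unfolding nodes_def labelling_def by blast

lemma subtree_gf_rep:
  "labelling B rep \<Longrightarrow> \<pi> \<in> avoiders B \<Longrightarrow> subtree_gf B (rep \<pi>) = subtree_gf B \<pi>"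
  using subtree_gf_equiv unfolding labelling_def by metis

text \<open>Passing from the children to their representatives does not change the series.\<close>

lemma subtree_gf_succession:
  assumes "labelling B rep" "succession B rep x U"
  shows "subtree_gf B x = 1 + fps_X * (\<Sum>y\<in>#U. subtree_gf B y)"
proof -
  have "(\<Sum>y\<in>#U. subtree_gf B y :: 'a fps)
      = (\<Sum>c\<in>children B x. subtree_gf B (rep c))"
    using assms(2) unfolding succession_def
    by (auto simp: sum_unfold_sum_mset multiset.map_comp comp_def)
  also have "\<dots> = (\<Sum>c\<in>children B x. subtree_gf B c)"
    by (intro sum.cong refl subtree_gf_rep[OF assms(1)] children_avoiders)
  finally show ?thesis
    using subtree_gf_rec by metis
qed

text \<open>A node represents itself, so being equivalent to \<open>w\<close> means having
  representative \<open>w\<close>.\<close>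

lemma edge_count_succession:
  assumes "labelling B rep" "succession B rep x U" "w \<in> nodes B rep"
  shows "edge_count B x w = count U w"
proof -
  have "tree_equiv B c w \<longleftrightarrow> rep c = w" if "c \<in> children B x" for c
    using children_avoiders[OF that] assms(1) rep_node[OF assms(1,3)] node_avoider[OF assms(1,3)]
    unfolding labelling_def by metis
  then have "{c \<in> children B x. tree_equiv B c w} = {c \<in> children B x. rep c = w}"
    by blast
  moreover have "count (image_mset rep (mset_set (children B x))) w
      = card {c \<in> children B x. rep c = w}"
    by (simp add: count_image_mset' finite_children eq_commute[of w])
  ultimately show ?thesis
    using assms(2) unfolding succession_def edge_count_def by simp
qed

lemma sum_mset_replicate: "(\<Sum>y\<in>#replicate_mset n x. f y) = of_nat n * (f x :: 'b::comm_semiring_1)"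
  by (induction n) (simp_all add: algebra_simps)

lemma sum_mset_image_sum:
  "(\<Sum>y\<in>#(\<Sum>w\<in>W. m w). f y) = (\<Sum>w\<in>W. \<Sum>y\<in>#m w. (f y :: 'b::comm_monoid_add))"
  by (induction W rule: infinite_finite_induct) simp_all

text \<open>Replaces the exponents of the rule by edge counts, the quantities assumed to have
  rational generating functions. As \<open>U\<close> is disjoint from \<open>W\<close>, each
  exponent is the full multiplicity.\<close>

lemma subtree_gf_succession_edge_count:
  assumes lab: "labelling B rep"
    and succ: "succession B rep x (U + (\<Sum>w\<in>W. replicate_mset (p w) w))"
    and W: "finite W" "W \<subseteq> nodes B rep" "set_mset U \<inter> W = {}"
  shows "subtree_gf B x = 1 + fps_X * ((\<Sum>y\<in>#U. subtree_gf B y)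
           + (\<Sum>w\<in>W. of_nat (edge_count B x w) * subtree_gf B w))"
proof -
  have "edge_count B x w = p w" if "w \<in> W" for w
  proof -
    have "count U w = 0"
      using that W(3) by (auto simp: not_in_iff[symmetric])
    then show ?thesis
      using edge_count_succession[OF lab succ, of w] that W by (auto simp: count_sum sum.delta)
  qed
  then show ?thesis
    using subtree_gf_succession[OF lab succ]
    by (simp add: sum_mset_image_sum sum_mset_replicate)
qed

lemma sum_mset_image_lessThan:
  "(\<Sum>y\<in>#image_mset v (mset_set {..<k}). f y) = (\<Sum>i<k. f (v i))"
  by (simp add: sum_unfold_sum_mset multiset.map_comp comp_def)

section \<open>Rationality of the generating function\<close>

theorem theorem15:
  fixes B :: "perm set" and rep :: "perm \<Rightarrow> perm"
    and \<alpha> :: nat and v :: "nat \<Rightarrow> nat \<Rightarrow> perm" and W :: "perm set"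
  assumes "B \<subseteq> perms" and "[1] \<notin> B"
    and "labelling B rep"
    and "growing_paths B rep \<alpha> v W"
    and "\<And>i w. i \<in> {1..\<alpha>} \<Longrightarrow> w \<in> W \<Longrightarrow>
           rational_fps (Abs_fps (\<lambda>j. of_nat (edge_count B (v i j) w)) :: 'a::field_char_0 fps)"
  shows "rational_fps (avoiders_gf B :: 'a fps)"
proof -
  note lab = \<open>labelling B rep\<close>
  have \<alpha>: "\<alpha> \<ge> 1" and W: "finite W"
    and nodes: "nodes B rep = (\<Union>j\<in>{1..\<alpha>}. range (v j)) \<union> W"
    and disj: "\<And>j k. j \<in> {1..\<alpha>} \<Longrightarrow> v j k \<notin> W"
    using assms(4) unfolding growing_paths_def by blast+
  obtain q :: "nat \<Rightarrow> nat" and r :: "nat \<Rightarrow> nat" and rr :: "nat \<Rightarrow> nat \<Rightarrow> nat" and r' :: nat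
    and p :: "nat \<Rightarrow> nat \<Rightarrow> perm \<Rightarrow> nat" where
    succ1: "\<And>k. succession B rep (v 1 k)
           (image_mset (v 1) (mset_set {..<k}) + replicate_mset (r 1) (v 1 k)
            + (\<Sum>w\<in>W. replicate_mset (p 1 k w) w))"
    and succ2: "\<And>s. 2 \<le> s \<Longrightarrow> s < \<alpha> \<Longrightarrow> 1 \<le> q s \<and> q s < s \<and>
           (\<forall>k. succession B rep (v s k)
              (image_mset (v (q s)) (mset_set {..<k}) + replicate_mset (r s) (v (q s) k)
               + replicate_mset (rr s 1) (v (q s) (k + 1)) + replicate_mset (rr s 2) (v s k)
               + (\<Sum>w\<in>W. replicate_mset (p s k w) w)))"
    and succ3: "\<alpha> \<ge> 2 \<Longrightarrow> 1 \<le> q \<alpha> \<and> q \<alpha> < \<alpha> \<and>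
           (\<forall>k. succession B rep (v \<alpha> k)
              (image_mset (v (q \<alpha>)) (mset_set {..<k}) + replicate_mset (r \<alpha>) (v (q \<alpha>) k)
               + replicate_mset r' (v \<alpha> k)
               + (\<Sum>i\<in>{1..\<alpha>}. replicate_mset (rr \<alpha> i) (v i (k + 1)))
               + (\<Sum>w\<in>W. replicate_mset (p \<alpha> k w) w)))"
    using assms(4) unfolding growing_paths_def by (elim conjE exE)
      (rule that, erule spec, erule allE, erule mp, rule conjI, assumption, assumption,
        erule mp, assumption)

  define g where "g \<pi> = (subtree_gf B \<pi> :: 'a fps)" for \<pi>
  define f where "f s k = g (v s k)" for s k
  \<comment> \<open>The part of the rule that does not involve the growing paths: the node itself
    and its children equivalent to members of \<open>W\<close>.\<close>
  define h where "h s k = 1 + fps_X * (\<Sum>w\<in>W. of_nat (edge_count B (v s k) w) * g w)" for s k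
  define M where
    "M = {c + (\<Sum>w\<in>W. A w * g w) | c A. rational_fps c \<and> (\<forall>w. rational_fps (A w))}"
  interpret rational_module M
    unfolding M_def by (rule rational_module_span)

  have one_M: "1 \<in> M"
    unfolding M_def by (auto intro!: exI[of _ 1] exI[of _ "\<lambda>_. 0"] rational_fps_intros)
  have g_M: "g w \<in> M" if "w \<in> W" for w
  proof -
    have "g w = 0 + (\<Sum>u\<in>W. (if u = w then 1 else 0) * g u)"
      using that W by (simp add: if_distrib[of "\<lambda>x. x * _"] sum.delta cong: if_cong)
    then show ?thesis
      unfolding M_def
      by (intro CollectI exI[of _ 0] exI[of _ "\<lambda>u. if u = w then 1 else 0"])
        (auto intro: rational_fps_intros)
  qed

  have rule: "f s k = h s k + fps_X * (\<Sum>y\<in>#U. g y)"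
    if "succession B rep (v s k) (U + (\<Sum>w\<in>W. replicate_mset (p s k w) w))"
      "set_mset U \<inter> W = {}" for s k U
    using subtree_gf_succession_edge_count[OF lab that(1) W _ that(2), where 'a = 'a] nodes
    unfolding f_def h_def g_def by (simp add: algebra_simps)

  \<comment> \<open>The assumed rationality of the edge counts enters here.\<close>
  have h: "module_rational (Abs_fps (h s))" if "s \<in> {1..\<alpha>}" for s
  proof -
    have "module_rational (Abs_fps (\<lambda>k. of_nat (edge_count B (v s k) w) * g w))" if "w \<in> W" for w
      using module_rational_scalar_seq[OF assms(5)[OF \<open>s \<in> {1..\<alpha>}\<close> that] g_M[OF that]]
      by (simp add: fps_of_nat)
    then show ?thesis
      unfolding h_def
      by (intro module_rational_seq_intros module_rational_const one_M rational_fps_X) assumption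
  qed

  have f1: "module_rational (Abs_fps (f 1))"
  proof (rule module_rational_cumulative)
    fix k
    have "set_mset (image_mset (v 1) (mset_set {..<k}) + replicate_mset (r 1) (v 1 k)) \<inter> W = {}"
      using disj[of 1] \<alpha> by auto
    from rule[OF succ1 this] show "f 1 k = h 1 k + fps_X * ((\<Sum>i<k. f 1 i) + of_nat (r 1) * f 1 k)"
      by (simp add: f_def sum_mset_image_lessThan sum_mset_replicate)
  qed (use h \<alpha> in \<open>auto intro: rational_fps_of_nat\<close>)

  \<comment> \<open>Strong induction works because \<open>q s < s\<close>: the rule refers to an
    earlier path and otherwise only to loops.\<close>
  have f: "module_rational (Abs_fps (f s))" if "1 \<le> s" "s < \<alpha>" for s
    using that
  proof (induction s rule: less_induct)
    case (less s)
    show ?case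
    proof (cases "s = 1")
      case True
      then show ?thesis
        using f1 by simp
    next
      case False
      then have s: "2 \<le> s" "s < \<alpha>"
        using less.prems by auto
      note succ = succ2[OF s]
      \<comment> \<open>All terms on the earlier path \<open>q s\<close>, together with
        \<open>h\<close>; only the loop of multiplicity \<open>rr s 2\<close> is left out.\<close>
      define u where "u k = h s k + fps_X * ((\<Sum>i<k. f (q s) i) + of_nat (r s) * f (q s) k
          + of_nat (rr s 1) * f (q s) (Suc k))" for k
      have "module_rational (Abs_fps (f (q s)))"
        using less.IH[of "q s"] succ s by simp
      then have u: "module_rational (Abs_fps u)"
        unfolding u_def using h[of s] s
        by (intro module_rational_seq_intros module_rational_Suc_seq[of "f (q s)"]
            rational_fps_X rational_fps_of_nat) auto
      have "f s k = u k + fps_X * (of_nat (rr s 2) * f s k)" for k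
      proof -
        let ?U = "image_mset (v (q s)) (mset_set {..<k}) + replicate_mset (r s) (v (q s) k)
               + replicate_mset (rr s 1) (v (q s) (k + 1)) + replicate_mset (rr s 2) (v s k)"
        have "set_mset ?U \<inter> W = {}"
          using disj[of s] disj[of "q s"] s succ by auto
        then have "f s k = h s k + fps_X * (\<Sum>y\<in>#?U. g y)"
          using rule[of s k ?U] succ by blast
        then show ?thesis
          by (simp add: u_def f_def sum_mset_image_lessThan sum_mset_replicate algebra_simps)
      qed
      with u rational_fps_of_nat show ?thesis
        by (rule module_rational_implicit)
    qed
  qed

  have f_M: "f s k \<in> M" if s: "s \<in> {1..\<alpha>}" for s k
  proof -
    \<comment> \<open>For \<open>\<alpha> = 1\<close> the only path follows the first rule and falls
      under the first case.\<close>
    consider "s = 1" | "1 \<le> s" "s < \<alpha>" | "s = \<alpha>" "\<alpha> \<ge> 2"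
      using s by fastforce
    then show ?thesis
    proof cases
      case 1
      then show ?thesis
        using module_rational_nth[OF f1, of k] by simp
    next
      case 2
      then show ?thesis
        using module_rational_nth[OF f, of s k] by simp
    next
      case 3
      note succ = succ3[OF 3(2)]
      \<comment> \<open>The sum omits \<open>i = \<alpha>\<close>: that term is the forward
        reference \<open>f \<alpha> (Suc k)\<close> left to the kernel method.\<close>
      define u where "u k = h \<alpha> k + fps_X * ((\<Sum>i<k. f (q \<alpha>) i) + of_nat (r \<alpha>) * f (q \<alpha>) k
          + (\<Sum>i\<in>{1..<\<alpha>}. of_nat (rr \<alpha> i) * f i (Suc k)))" for k
      have u: "module_rational (Abs_fps u)"
        unfolding u_def using h[of \<alpha>] f succ \<alpha>
        by (intro module_rational_seq_intros module_rational_Suc_seq[of "f _"]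
            rational_fps_X rational_fps_of_nat) auto
      have "f \<alpha> k = u k + fps_X * (of_nat r' * f \<alpha> k + of_nat (rr \<alpha> \<alpha>) * f \<alpha> (Suc k))" for k
      proof -
        let ?U = "image_mset (v (q \<alpha>)) (mset_set {..<k}) + replicate_mset (r \<alpha>) (v (q \<alpha>) k)
               + replicate_mset r' (v \<alpha> k)
               + (\<Sum>i\<in>{1..\<alpha>}. replicate_mset (rr \<alpha> i) (v i (k + 1)))"
        have "set_mset ?U \<inter> W = {}"
          using disj 3 succ by (auto simp: set_mset_sum split: if_splits)
        then have "f \<alpha> k = h \<alpha> k + fps_X * (\<Sum>y\<in>#?U. g y)"
          using rule[of \<alpha> k ?U] succ by blast
        moreover have "{1..\<alpha>} = insert \<alpha> {1..<\<alpha>}"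
          using \<alpha> by auto
        ultimately show ?thesis
          by (simp add: u_def f_def sum_mset_image_lessThan sum_mset_replicate
              sum_mset_image_sum algebra_simps)
      qed
      with u rational_fps_of_nat rational_fps_of_nat show ?thesis
        unfolding 3(1) by (rule mem_if_growing)
    qed
  qed

  \<comment> \<open>Every avoider is equivalent to a node, which lies on a growing path or in
    \<open>W\<close>.\<close>
  have node_M: "g \<pi> \<in> M" if "\<pi> \<in> avoiders B" for \<pi>
  proof -
    have "rep \<pi> \<in> nodes B rep"
      using that unfolding nodes_def by blast
    then have "g (rep \<pi>) \<in> M"
      using f_M g_M unfolding nodes f_def by auto
    then show ?thesis
      using subtree_gf_rep[OF lab that, where 'a = 'a] unfolding g_def by simp
  qed

  have g_rational: "rational_fps (g w)" if "w \<in> W" for w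
  proof (rule rational_fps_linear_system[OF W _ that])
    fix w
    \<comment> \<open>No succession rule is known for \<open>w\<close>, but its children are
      avoiders, so their series lie in \<open>M\<close>; the factor \<open>x\<close> in front then
      gives the required linear system.\<close>
    have "(\<Sum>c\<in>children B w. g c) \<in> M"
      by (intro sum_mem node_M children_avoiders)
    then obtain c A where c: "rational_fps c" and A: "\<forall>u. rational_fps (A u)"
      and eq: "(\<Sum>c\<in>children B w. g c) = c + (\<Sum>u\<in>W. A u * g u)"
      unfolding M_def by blast
    have "g w = 1 + fps_X * (\<Sum>c\<in>children B w. g c)"
      unfolding g_def by (rule subtree_gf_rec)
    then have "g w = (1 + fps_X * c) + fps_X * (\<Sum>u\<in>W. A u * g u)"
      by (simp add: eq algebra_simps)
    moreover have "rational_fps (1 + fps_X * c)"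
      using c by (intro rational_fps_intros)
    ultimately show "\<exists>c A. rational_fps c \<and> (\<forall>u. rational_fps (A u)) \<and>
        g w = c + fps_X * (\<Sum>u\<in>W. A u * g u)"
      using A by blast
  qed
  have M_rational: "rational_fps x" if x: "x \<in> M" for x
  proof -
    obtain c A where "rational_fps c" "\<And>w. rational_fps (A w)" "x = c + (\<Sum>w\<in>W. A w * g w)"
      using x unfolding M_def by blast
    then show ?thesis
      using g_rational by (auto intro!: rational_fps_add rational_fps_sum rational_fps_mult)
  qed
  have "[1] \<in> avoiders B"
    using avoiders_of_length_1[OF assms(1,2)] by (simp add: avoiders_iff)
  then have "rational_fps (g [1])"
    by (intro M_rational node_M)
  then show ?thesis
    unfolding avoiders_gf_eq[OF assms(1,2)] g_def by (intro rational_fps_mult rational_fps_X)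
qed

end
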